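(* Let $G$ be a finite group and $x\in G$. Let $\partial\colon E\to G$ be a surjective group homomorphism whose kernel $A$ is central in $E$, let $s\colon G\to E$ be any set-theoretic section of $\partial$, and consider the crossed module $(\partial\colon E\to G,\bullet)$ with $g\bullet e=s(g)\,e\,s(g)^{-1}$. For $g,h\in G$ put $\{g,h\}=[s(g),s(h)]\in E$. Then the pair $\Phi^x=(\phi^x,\psi^x)$ given by $$\phi^x(g,h)=\{hx^{-1},gx^{-1}\},\qquad \psi^x(g,h)=\{g,h\}\,\{hg^{-1},x\}$$ is an unframed Eisermann lifting for the crossed module $(\partial\colon E\to G,\bullet)$.
   Context: $[a,b]=aba^{-1}b^{-1}$. Neither the action $\bullet$ nor the bracket $\{\,,\}$ depends on the choice of section $s$. A crossed module of groups $(\partial\colon E\to G,\bullet)$ is a group homomorphism $\partial\colon E\to G$ with a left action $\bullet$ of $G$ on $E$ by automorphisms such that $\partial(g\bullet e)=g\,\partial(e)\,g^{-1}$ and $\partial(e)\bullet f=efe^{-1}$ for all $g\in G$, $e,f\in E$. An *unframed Reidemeister pair* for it consists of functions $\psi,\phi\colon G\times G\to E$ such that for all $X,Y,T\in G$: (R1) $\psi(X,X)=1_E$; (R2) $\phi(X,Y)\,\psi(X,Z)=1_E$ where $Z=X^{-1}\partial\phi(X,Y)^{-1}YX$; (R3) $\phi(Y,X)\cdot(Y\bullet\phi(T,Z))\cdot\phi(T,Y)=(X\bullet\phi(T,Y))\cdot\phi(T,X)\cdot(T\bullet\phi(V,W))$ where $Z=Y^{-1}\partial\phi(Y,X)^{-1}XY$,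 $V=T^{-1}\partial\phi(T,Y)^{-1}YT$, $W=T^{-1}\partial\phi(T,X)^{-1}XT$. An *unframed Eisermann lifting*, for a finite group $G$ and $x\in G$, is a crossed module $(\partial\colon E\to G,\bullet)$ together with an unframed Reidemeister pair consisting of $\phi^x,\psi^x\colon G\times G\to E$ such that for all $L,M\in G$: $\partial(\phi^x(L,M))=[Mx^{-1},Lx^{-1}]$ and $\partial(\psi^x(L,M))=[L,M]\,[ML^{-1},x]$. *)

theory Defs
  imports "HOL-Algebra.Coset" "HOL-Algebra.Bij"
begin

definition comm :: "('a, 'm) monoid_scheme \<Rightarrow> 'a \<Rightarrow> 'a \<Rightarrow> 'a" where
  "comm G a b = a \<otimes>\<^bsub>G\<^esub> b \<otimes>\<^bsub>G\<^esub> inv\<^bsub>G\<^esub> a \<otimes>\<^bsub>G\<^esub> inv\<^bsub>G\<^esub> b"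

text \<open>The action is a homomorphism from G to the library's automorphism group of E. The elements
  of the latter are extensional functions, hence the restriction to the carrier.\<close>

definition crossed_module ::
  "('e, 'm) monoid_scheme \<Rightarrow> ('g, 'n) monoid_scheme \<Rightarrow> ('e \<Rightarrow> 'g) \<Rightarrow> ('g \<Rightarrow> 'e \<Rightarrow> 'e) \<Rightarrow> bool" where
  "crossed_module E G \<delta> act \<longleftrightarrow>
     group E \<and> group G \<and> \<delta> \<in> hom E G \<and>
     (\<lambda>g. restrict (act g) (carrier E)) \<in> hom G (AutoGroup E) \<and>
     (\<forall>g\<in>carrier G. \<forall>e\<in>carrier E.
        \<delta> (act g e) = g \<otimes>\<^bsub>G\<^esub> \<delta> e \<otimes>\<^bsub>G\<^esub> inv\<^bsub>G\<^esub> g) \<and>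
     (\<forall>e\<in>carrier E. \<forall>f\<in>carrier E.
        act (\<delta> e) f = e \<otimes>\<^bsub>E\<^esub> f \<otimes>\<^bsub>E\<^esub> inv\<^bsub>E\<^esub> e)"

text \<open>The common shape of the elements Z, V, W in the Reidemeister conditions below.\<close>

definition under_colour ::
  "('g, 'n) monoid_scheme \<Rightarrow> ('e \<Rightarrow> 'g) \<Rightarrow> ('g \<Rightarrow> 'g \<Rightarrow> 'e) \<Rightarrow> 'g \<Rightarrow> 'g \<Rightarrow> 'g" where
  "under_colour G \<delta> \<phi> X Y =
     inv\<^bsub>G\<^esub> X \<otimes>\<^bsub>G\<^esub> inv\<^bsub>G\<^esub> (\<delta> (\<phi> X Y)) \<otimes>\<^bsub>G\<^esub> Y \<otimes>\<^bsub>G\<^esub> X"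

definition unframed_Reidemeister_pair ::
  "('e, 'm) monoid_scheme \<Rightarrow> ('g, 'n) monoid_scheme \<Rightarrow> ('e \<Rightarrow> 'g) \<Rightarrow> ('g \<Rightarrow> 'e \<Rightarrow> 'e) \<Rightarrow>
   ('g \<Rightarrow> 'g \<Rightarrow> 'e) \<Rightarrow> ('g \<Rightarrow> 'g \<Rightarrow> 'e) \<Rightarrow> bool" where
  "unframed_Reidemeister_pair E G \<delta> act \<phi> \<psi> \<longleftrightarrow>
     \<phi> \<in> carrier G \<rightarrow> carrier G \<rightarrow> carrier E \<and>
     \<psi> \<in> carrier G \<rightarrow> carrier G \<rightarrow> carrier E \<and>
     (\<forall>X\<in>carrier G. \<psi> X X = \<one>\<^bsub>E\<^esub>) \<and>
     (\<forall>X\<in>carrier G. \<forall>Y\<in>carrier G.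
        \<phi> X Y \<otimes>\<^bsub>E\<^esub> \<psi> X (under_colour G \<delta> \<phi> X Y) = \<one>\<^bsub>E\<^esub>) \<and>
     (\<forall>X\<in>carrier G. \<forall>Y\<in>carrier G. \<forall>T\<in>carrier G.
        let Z = under_colour G \<delta> \<phi> Y X;
            V = under_colour G \<delta> \<phi> T Y;
            W = under_colour G \<delta> \<phi> T X
        in \<phi> Y X \<otimes>\<^bsub>E\<^esub> act Y (\<phi> T Z) \<otimes>\<^bsub>E\<^esub> \<phi> T Y
           = act X (\<phi> T Y) \<otimes>\<^bsub>E\<^esub> \<phi> T X \<otimes>\<^bsub>E\<^esub> act T (\<phi> V W))"

definition unframed_Eisermann_lifting ::
  "('e, 'm) monoid_scheme \<Rightarrow> ('g, 'n) monoid_scheme \<Rightarrow> ('e \<Rightarrow> 'g) \<Rightarrow> ('g \<Rightarrow> 'e \<Rightarrow> 'e) \<Rightarrow> 'g \<Rightarrow>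
   ('g \<Rightarrow> 'g \<Rightarrow> 'e) \<Rightarrow> ('g \<Rightarrow> 'g \<Rightarrow> 'e) \<Rightarrow> bool" where
  "unframed_Eisermann_lifting E G \<delta> act x \<phi> \<psi> \<longleftrightarrow>
     finite (carrier G) \<and> x \<in> carrier G \<and>
     crossed_module E G \<delta> act \<and>
     unframed_Reidemeister_pair E G \<delta> act \<phi> \<psi> \<and>
     (\<forall>L\<in>carrier G. \<forall>M\<in>carrier G.
        \<delta> (\<phi> L M) = comm G (M \<otimes>\<^bsub>G\<^esub> inv\<^bsub>G\<^esub> x) (L \<otimes>\<^bsub>G\<^esub> inv\<^bsub>G\<^esub> x) \<and>
        \<delta> (\<psi> L M) = comm G L M \<otimes>\<^bsub>G\<^esub> comm G (M \<otimes>\<^bsub>G\<^esub> inv\<^bsub>G\<^esub> L) x)"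

definition section_act ::
  "('e, 'm) monoid_scheme \<Rightarrow> ('g \<Rightarrow> 'e) \<Rightarrow> 'g \<Rightarrow> 'e \<Rightarrow> 'e" where
  "section_act E s g e = s g \<otimes>\<^bsub>E\<^esub> e \<otimes>\<^bsub>E\<^esub> inv\<^bsub>E\<^esub> (s g)"

definition section_bracket ::
  "('e, 'm) monoid_scheme \<Rightarrow> ('g \<Rightarrow> 'e) \<Rightarrow> 'g \<Rightarrow> 'g \<Rightarrow> 'e" where
  "section_bracket E s g h = comm E (s g) (s h)"

definition Eisermann_phi ::
  "('e, 'm) monoid_scheme \<Rightarrow> ('g, 'n) monoid_scheme \<Rightarrow> ('g \<Rightarrow> 'e) \<Rightarrow> 'g \<Rightarrow> 'g \<Rightarrow> 'g \<Rightarrow> 'e" where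
  "Eisermann_phi E G s x g h =
     section_bracket E s (h \<otimes>\<^bsub>G\<^esub> inv\<^bsub>G\<^esub> x) (g \<otimes>\<^bsub>G\<^esub> inv\<^bsub>G\<^esub> x)"

definition Eisermann_psi ::
  "('e, 'm) monoid_scheme \<Rightarrow> ('g, 'n) monoid_scheme \<Rightarrow> ('g \<Rightarrow> 'e) \<Rightarrow> 'g \<Rightarrow> 'g \<Rightarrow> 'g \<Rightarrow> 'e" where
  "Eisermann_psi E G s x g h =
     section_bracket E s g h \<otimes>\<^bsub>E\<^esub> section_bracket E s (h \<otimes>\<^bsub>G\<^esub> inv\<^bsub>G\<^esub> g) x"

end

theory Submission
  imports Defs "HOL-Algebra.Group_Action"
begin

text \<open>Since the kernel is central, conjugation by an element of \<open>E\<close> and the commutator of two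
  elements of \<open>E\<close> depend only on the images under \<open>\<delta>\<close>. Hence every bracket in the Reidemeister
  conditions may be computed from any convenient lifts. Lifting all colours to words in
  \<open>a = s X\<close>, \<open>b = s Y\<close>, \<open>t = s T\<close>, \<open>k = s x\<close>, both conditions (R2) and (R3) become
  identities that already hold in the free group on \<open>a\<close>, \<open>b\<close>, \<open>t\<close>, \<open>k\<close>.\<close>

context group
begin

text \<open>With these two cancellation rules, rewriting by \<open>m_assoc\<close> and
  \<open>inv_mult_group\<close> brings group words to reduced right-nested form, so simplification
  alone settles free-group identities.\<close>

lemma inv_cancel_left [simp]:
  "a \<in> carrier G \<Longrightarrow> b \<in> carrier G \<Longrightarrow> inv a \<otimes> (a \<otimes> b) = b"
  by (simp flip: m_assoc)

lemma cancel_inv_left [simp]: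
  "a \<in> carrier G \<Longrightarrow> b \<in> carrier G \<Longrightarrow> a \<otimes> (inv a \<otimes> b) = b"
  by (simp flip: m_assoc)

lemma comm_closed [simp]:
  "a \<in> carrier G \<Longrightarrow> b \<in> carrier G \<Longrightarrow> comm G a b \<in> carrier G"
  by (simp add: comm_def)

lemma comm_self:
  "a \<in> carrier G \<Longrightarrow> comm G a a = \<one>"
  by (simp add: comm_def m_assoc)

lemma comm_one_left:
  "a \<in> carrier G \<Longrightarrow> comm G \<one> a = \<one>"
  by (simp add: comm_def)

text \<open>The commutator reduces to \<open>b k^-1 a b^-1 k a^-1\<close>; its inverse cancels
  against \<open>a^-1\<close> on the left and \<open>b\<close> on the right.\<close>

lemma under_colour_word:
  assumes "a \<in> carrier G" "b \<in> carrier G" "k \<in> carrier G"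
  shows "inv a \<otimes> inv (comm G (b \<otimes> inv k) (a \<otimes> inv k)) \<otimes> b \<otimes> a
    = inv k \<otimes> b \<otimes> inv a \<otimes> k \<otimes> a"
  using assms by (simp add: comm_def m_assoc inv_mult_group)

text \<open>Since \<open>z a^-1 = k^-1 (b a^-1) k\<close>, the last commutator is
  \<open>z b^-1\<close>. The bracketed product is then \<open>a z a^-1 b^-1\<close>, the inverse of
  the first commutator.\<close>

lemma Reidemeister_II_word:
  assumes "a \<in> carrier G" "b \<in> carrier G" "k \<in> carrier G"
  defines "z \<equiv> inv k \<otimes> b \<otimes> inv a \<otimes> k \<otimes> a"
  shows "comm G (b \<otimes> inv k) (a \<otimes> inv k) \<otimes> (comm G a z \<otimes> comm G (z \<otimes> inv a) k) = \<one>"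
  using assms by (simp add: comm_def m_assoc inv_mult_group)

text \<open>Write \<open>u(g,h) = k^-1 h g^-1 k g\<close>. The commutator \<open>c\<close> of
  \<open>h k^-1\<close> and \<open>g k^-1\<close> satisfies \<open>c g u(g,h) = h g\<close>. Hence
  the left side times \<open>t v u(t,z)\<close> and the right side times \<open>t v u(v,w)\<close>
  both telescope to \<open>a b t\<close>, and \<open>u(t,z) = u(v,w)\<close> is the
  self-distributivity of the colouring.\<close>

lemma Reidemeister_III_word:
  assumes "a \<in> carrier G" "b \<in> carrier G" "t \<in> carrier G" "k \<in> carrier G"
  defines "z \<equiv> inv k \<otimes> a \<otimes> inv b \<otimes> k \<otimes> b"
    and "v \<equiv> inv k \<otimes> b \<otimes> inv t \<otimes> k \<otimes> t"
    and "w \<equiv> inv k \<otimes> a \<otimes> inv t \<otimes> k \<otimes> t"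
  shows "comm G (a \<otimes> inv k) (b \<otimes> inv k)
      \<otimes> (b \<otimes> comm G (z \<otimes> inv k) (t \<otimes> inv k) \<otimes> inv b)
      \<otimes> comm G (b \<otimes> inv k) (t \<otimes> inv k)
    = (a \<otimes> comm G (b \<otimes> inv k) (t \<otimes> inv k) \<otimes> inv a)
      \<otimes> comm G (a \<otimes> inv k) (t \<otimes> inv k)
      \<otimes> (t \<otimes> comm G (w \<otimes> inv k) (v \<otimes> inv k) \<otimes> inv t)"
  using assms by (simp add: comm_def m_assoc inv_mult_group)

end

lemma (in group_hom) hom_comm:
  "a \<in> carrier G \<Longrightarrow> b \<in> carrier G \<Longrightarrow> h (comm G a b) = comm H (h a) (h b)"
  by (simp add: comm_def)

locale central_extension = group_hom E G \<delta>
  for E :: "('e, 'm) monoid_scheme" (structure)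
    and G :: "('g, 'n) monoid_scheme" (structure)
    and \<delta> :: "'e \<Rightarrow> 'g" +
  fixes s :: "'g \<Rightarrow> 'e"
  assumes central: "\<And>a e. a \<in> kernel E G \<delta> \<Longrightarrow> e \<in> carrier E \<Longrightarrow> a \<otimes> e = e \<otimes> a"
    and section_closed [simp]: "\<And>g. g \<in> carrier G \<Longrightarrow> s g \<in> carrier E"
    and section_right_inverse [simp]: "\<And>g. g \<in> carrier G \<Longrightarrow> \<delta> (s g) = g"
begin

lemma conj_cong_hom:
  assumes "a \<in> carrier E" "a' \<in> carrier E" "e \<in> carrier E" "\<delta> a = \<delta> a'"
  shows "a \<otimes> e \<otimes> inv a = a' \<otimes> e \<otimes> inv a'"
proof -
  \<comment> \<open>Two lifts of one element differ by a kernel element, which is central and so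
    conjugates trivially.\<close>
  define c where "c = inv a' \<otimes> a"
  have c: "c \<in> carrier E" "c \<in> kernel E G \<delta>"
    using assms by (simp_all add: c_def kernel_def)
  have a: "a = a' \<otimes> c"
    using assms by (simp add: c_def)
  have "c \<otimes> e \<otimes> inv c = e"
    using c assms by (simp add: central[of c e]) (simp add: G.m_assoc)
  then have "a' \<otimes> (c \<otimes> e \<otimes> inv c) \<otimes> inv a'
      = a' \<otimes> e \<otimes> inv a'"
    by simp
  then show ?thesis
    using c assms(1-3) by (simp add: a G.m_assoc G.inv_mult_group)
qed

text \<open>As \<open>s\<close> need not be multiplicative, the freedom to choose the lift is
  essential: products of values of \<open>s\<close> may replace the value of \<open>s\<close> at a
  product.\<close>

lemma section_act_eq:
  assumes "a \<in> carrier E" "e \<in> carrier E" "\<delta> a = g"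
  shows "section_act E s g e = a \<otimes> e \<otimes> inv a"
  unfolding section_act_def using assms by (intro conj_cong_hom) auto

lemma comm_cong_hom:
  assumes "a \<in> carrier E" "a' \<in> carrier E" "b \<in> carrier E" "b' \<in> carrier E"
    and "\<delta> a = \<delta> a'" "\<delta> b = \<delta> b'"
  shows "comm E a b = comm E a' b'"
proof -
  have "comm E a b = a \<otimes> b \<otimes> inv a \<otimes> inv b"
    by (simp add: comm_def)
  \<comment> \<open>A commutator contains a conjugate by \<open>a\<close> and, after regrouping, a
    conjugate by \<open>b\<close>, so the two lifts can be exchanged one after the other.\<close>
  also have "\<dots> = a' \<otimes> b \<otimes> inv a' \<otimes> inv b"
    using assms by (simp add: conj_cong_hom[of a a'])
  also have "\<dots> = a' \<otimes> (b \<otimes> inv a' \<otimes> inv b)"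
    using assms by (simp add: G.m_assoc)
  also have "\<dots> = a' \<otimes> (b' \<otimes> inv a' \<otimes> inv b')"
    using assms by (simp add: conj_cong_hom[of b b'])
  finally show ?thesis
    using assms by (simp add: comm_def G.m_assoc)
qed

lemma section_bracket_eq:
  assumes "a \<in> carrier E" "b \<in> carrier E" "\<delta> a = g" "\<delta> b = h"
  shows "section_bracket E s g h = comm E a b"
  unfolding section_bracket_def using assms by (intro comm_cong_hom) auto

lemma crossed_module_section_act: "crossed_module E G \<delta> (section_act E s)"
proof -
  \<comment> \<open>The conjugation action of \<open>E\<close> on itself supplies the bijectivity of
    each \<open>section_act E s g\<close>.\<close>
  interpret C: group_action E "carrier E"
    "\<lambda>g. \<lambda>h\<in>carrier E. g \<otimes> h \<otimes> inv g"
    by (rule G.action_by_conjugation)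
  let ?c = "\<lambda>g. restrict (section_act E s g) (carrier E)"
  have bij: "?c g \<in> Bij (carrier E)" if "g \<in> carrier G" for g
    using that C.bij_prop0[of "s g"] by (simp add: Bij_def section_act_def[abs_def])
  have auto: "?c g \<in> carrier (AutoGroup E)" if "g \<in> carrier G" for g
    using that bij[OF that]
    by (simp add: AutoGroup_def auto_def hom_def section_act_def G.m_assoc Pi_iff)
  have "?c (g \<otimes>\<^bsub>G\<^esub> h) = ?c g \<otimes>\<^bsub>AutoGroup E\<^esub> ?c h"
    if "g \<in> carrier G" "h \<in> carrier G" for g h
  proof -
    have "section_act E s (g \<otimes>\<^bsub>G\<^esub> h) e = section_act E s g (section_act E s h e)"
      if "e \<in> carrier E" for e
      using that \<open>g \<in> carrier G\<close> \<open>h \<in> carrier G\<close>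
      \<comment> \<open>\<open>s g \<otimes> s h\<close> serves as the lift of the product of
        \<open>g\<close> and \<open>h\<close>.\<close>
      by (simp add: section_act_eq[of "s g \<otimes> s h"])
        (simp add: section_act_def G.m_assoc G.inv_mult_group)
    then show ?thesis
      using that bij
      by (auto simp: AutoGroup_def BijGroup_def compose_def restrict_def section_act_def)
  qed
  with auto have "?c \<in> hom G (AutoGroup E)"
    by (simp add: hom_def)
  then show ?thesis
    using G.is_group H.is_group homh section_act_eq
    by (simp add: crossed_module_def section_act_def)
qed

context
  fixes x
  assumes x [simp]: "x \<in> carrier G"
begin

lemma Eisermann_phi_eq:
  assumes "a \<in> carrier E" "b \<in> carrier E" "\<delta> a = g" "\<delta> b = h"
  shows "Eisermann_phi E G s x g h = comm E (b \<otimes> inv s x) (a \<otimes> inv s x)"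
  unfolding Eisermann_phi_def using assms by (intro section_bracket_eq) auto

lemma Eisermann_psi_eq:
  assumes "a \<in> carrier E" "b \<in> carrier E" "\<delta> a = g" "\<delta> b = h"
  shows "Eisermann_psi E G s x g h = comm E a b \<otimes> comm E (b \<otimes> inv a) (s x)"
  unfolding Eisermann_psi_def using assms
  by (simp add: section_bracket_eq[of a b] section_bracket_eq[of "b \<otimes> inv a" "s x"])

lemma hom_Eisermann_phi:
  assumes "g \<in> carrier G" "h \<in> carrier G"
  shows "\<delta> (Eisermann_phi E G s x g h) = comm G (h \<otimes>\<^bsub>G\<^esub> inv\<^bsub>G\<^esub> x) (g \<otimes>\<^bsub>G\<^esub> inv\<^bsub>G\<^esub> x)"
  using assms by (simp add: Eisermann_phi_eq[of "s g" "s h"] hom_comm)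

lemma hom_Eisermann_psi:
  assumes "g \<in> carrier G" "h \<in> carrier G"
  shows "\<delta> (Eisermann_psi E G s x g h) = comm G g h \<otimes>\<^bsub>G\<^esub> comm G (h \<otimes>\<^bsub>G\<^esub> inv\<^bsub>G\<^esub> g) x"
  using assms by (simp add: Eisermann_psi_eq[of "s g" "s h"] hom_comm)

text \<open>Provides lifts of the colours Z, V, W that are explicit words in values of
  \<open>s\<close>, unlike the values of \<open>s\<close> at those colours.\<close>

lemma hom_under_colour_lift:
  assumes "g \<in> carrier G" "h \<in> carrier G"
  shows "\<delta> (inv s x \<otimes> s h \<otimes> inv s g \<otimes> s x \<otimes> s g)
    = under_colour G \<delta> (Eisermann_phi E G s x) g h"
  using assms by (simp add: under_colour_def hom_Eisermann_phi H.under_colour_word)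

lemma unframed_Reidemeister_pair_Eisermann:
  "unframed_Reidemeister_pair E G \<delta> (section_act E s) (Eisermann_phi E G s x) (Eisermann_psi E G s x)"
  unfolding unframed_Reidemeister_pair_def Let_def
proof (intro conjI ballI)
  let ?\<phi> = "Eisermann_phi E G s x" and ?\<psi> = "Eisermann_psi E G s x"
  let ?u = "under_colour G \<delta> ?\<phi>"
  define z where "z g h = inv s x \<otimes> s h \<otimes> inv s g \<otimes> s x \<otimes> s g" for g h
  have z: "z g h \<in> carrier E" "\<delta> (z g h) = ?u g h"
    if "g \<in> carrier G" "h \<in> carrier G" for g h
    using that unfolding z_def by (simp_all only: hom_under_colour_lift) simp
  show "?\<phi> \<in> carrier G \<rightarrow> carrier G \<rightarrow> carrier E"
    by (simp add: Eisermann_phi_def section_bracket_def)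
  show "?\<psi> \<in> carrier G \<rightarrow> carrier G \<rightarrow> carrier E"
    by (simp add: Eisermann_psi_def section_bracket_def)
  fix X assume X: "X \<in> carrier G"
  then show "?\<psi> X X = \<one>"
    by (simp add: Eisermann_psi_eq[of "s X" "s X"] G.comm_self G.comm_one_left)
  fix Y assume Y: "Y \<in> carrier G"
  show "?\<phi> X Y \<otimes> ?\<psi> X (?u X Y) = \<one>"
    using X Y z G.Reidemeister_II_word[of "s X" "s Y" "s x"]
    by (simp add: Eisermann_phi_eq[of "s X" "s Y"] Eisermann_psi_eq[of "s X" "z X Y"]
        flip: z_def)
  fix T assume T: "T \<in> carrier G"
  \<comment> \<open>Original colours are lifted by \<open>s\<close> and derived ones by
    \<open>z\<close>; \<open>z Y X\<close>, \<open>z T Y\<close> and \<open>z T X\<close> are the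
    \<open>z\<close>, \<open>v\<close> and \<open>w\<close> of the word identity for (R3).\<close>
  have "?\<phi> Y X = comm E (s X \<otimes> inv s x) (s Y \<otimes> inv s x)"
    and "?\<phi> T X = comm E (s X \<otimes> inv s x) (s T \<otimes> inv s x)"
    and "?\<phi> T Y = comm E (s Y \<otimes> inv s x) (s T \<otimes> inv s x)"
    and "?\<phi> T (?u Y X) = comm E (z Y X \<otimes> inv s x) (s T \<otimes> inv s x)"
    and "?\<phi> (?u T Y) (?u T X)
      = comm E (z T X \<otimes> inv s x) (z T Y \<otimes> inv s x)"
    using X Y T z by (intro Eisermann_phi_eq; simp)+
  then show "?\<phi> Y X \<otimes> section_act E s Y (?\<phi> T (?u Y X)) \<otimes> ?\<phi> T Y
    = section_act E s X (?\<phi> T Y) \<otimes> ?\<phi> T X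
      \<otimes> section_act E s T (?\<phi> (?u T Y) (?u T X))"
    using X Y T G.Reidemeister_III_word[of "s X" "s Y" "s T" "s x"]
    by (simp add: section_act_def flip: z_def)
qed

end

end

theorem theorem4p17:
  fixes E :: "('e, 'm) monoid_scheme" and G :: "('g, 'n) monoid_scheme"
    and \<delta> :: "'e \<Rightarrow> 'g" and s :: "'g \<Rightarrow> 'e" and x :: 'g
  assumes "group G" and "finite (carrier G)" and "x \<in> carrier G"
    and "group E"
    and "\<delta> \<in> hom E G" and "\<delta> ` carrier E = carrier G"
    and "\<And>a e. a \<in> kernel E G \<delta> \<Longrightarrow> e \<in> carrier E \<Longrightarrow> a \<otimes>\<^bsub>E\<^esub> e = e \<otimes>\<^bsub>E\<^esub> a"
    and "\<And>g. g \<in> carrier G \<Longrightarrow> s g \<in> carrier E \<and> \<delta> (s g) = g"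
  shows "unframed_Eisermann_lifting E G \<delta> (section_act E s) x
           (Eisermann_phi E G s x) (Eisermann_psi E G s x)"
proof -
  interpret central_extension E G \<delta> s
    using assms
    by (auto simp add: central_extension_def group_hom_def group_hom_axioms_def
        central_extension_axioms_def)
  show ?thesis
    using assms crossed_module_section_act unframed_Reidemeister_pair_Eisermann
    by (simp add: unframed_Eisermann_lifting_def hom_Eisermann_phi hom_Eisermann_psi)
qed

end
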